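(* Let $E_{\mathbb{R}}=\{az^2+bzw+cw^2 : (a,b,c)\in\mathbb{R}^3\}$, regarded as a real subspace of the space of $2$-homogeneous complex polynomials on $\ell_\infty^2(\mathbb{C})$. Then $$D_{\mathbb{C},2}(E_{\mathbb{R}})=\sqrt[4]{\tfrac{3}{2}}.$$ Moreover, $$D_{\mathbb{C},2}(2)=\sqrt[4]{\tfrac{3}{2}}\approx 1.1066.$$
   Context: For a $2$-homogeneous polynomial $P(z,w)=az^2+bzw+cw^2$ with $a,b,c\in\mathbb{C}$, put $$\|P\|=\sup\{|P(z,w)| : z,w\in\mathbb{C},\ |z|\le 1,\ |w|\le 1\},\qquad |P|_{4/3}=\left(|a|^{4/3}+|b|^{4/3}+|c|^{4/3}\right)^{3/4}.$$ $\mathcal{P}(^2\ell_\infty^2(\mathbb{C}))$ denotes the space of all such polynomials with the norm $\|\cdot\|$. For a subset $E\subseteq\mathcal{P}(^2\ell_\infty^2(\mathbb{C}))$, $$D_{\mathbb{C},2}(E)=\inf\{D>0 : |P|_{4/3}\le D\|P\|\ \text{for all } P\in E\},$$ and $D_{\mathbb{C},2}(2)=D_{\mathbb{C},2}(\mathcal{P}(^2\ell_\infty^2(\mathbb{C})))$. *)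

theory Defs
  imports Complex_Main
begin

definition hpoly :: "complex \<Rightarrow> complex \<Rightarrow> complex \<Rightarrow> complex \<Rightarrow> complex \<Rightarrow> complex" where
  "hpoly a b c = (\<lambda>z w. a * z\<^sup>2 + b * z * w + c * w\<^sup>2)"

definition hpolys :: "(complex \<Rightarrow> complex \<Rightarrow> complex) set" where
  "hpolys = {hpoly a b c | a b c. True}"

definition real_hpolys :: "(complex \<Rightarrow> complex \<Rightarrow> complex) set" where
  "real_hpolys = {hpoly (of_real a) (of_real b) (of_real c) | (a::real) (b::real) (c::real). True}"

text \<open>The supremum runs over the closed unit ball of the two-dimensional complex
  sup-norm space, i.e. the closed bidisc.\<close>

definition sup_norm :: "(complex \<Rightarrow> complex \<Rightarrow> complex) \<Rightarrow> real" where
  "sup_norm P = Sup {cmod (P z w) | z w. cmod z \<le> 1 \<and> cmod w \<le> 1}"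

text \<open>Polynomials are functions here, so the coefficients are recovered by unique
  description; this is meaningful only on \<^const>\<open>hpolys\<close>.\<close>

definition hcoeffs :: "(complex \<Rightarrow> complex \<Rightarrow> complex) \<Rightarrow> complex \<times> complex \<times> complex" where
  "hcoeffs P = (THE (a, b, c). P = hpoly a b c)"

lemma hpoly_inject: "hpoly a b c = hpoly a' b' c' \<longleftrightarrow> a = a' \<and> b = b' \<and> c = c'"
proof
  assume eq: "hpoly a b c = hpoly a' b' c'"
  have "a = a'" using fun_cong[OF fun_cong[OF eq, of 1], of 0] by (simp add: hpoly_def)
  moreover have "c = c'" using fun_cong[OF fun_cong[OF eq, of 0], of 1] by (simp add: hpoly_def)
  moreover have "a + b + c = a' + b' + c'"
    using fun_cong[OF fun_cong[OF eq, of 1], of 1] by (simp add: hpoly_def)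
  ultimately show "a = a' \<and> b = b' \<and> c = c'" by simp
qed simp

lemma hcoeffs_hpoly [simp]: "hcoeffs (hpoly a b c) = (a, b, c)"
  unfolding hcoeffs_def by (rule the_equality) (auto simp: hpoly_inject)

definition coeff_norm :: "(complex \<Rightarrow> complex \<Rightarrow> complex) \<Rightarrow> real" where
  "coeff_norm P = (case hcoeffs P of (a, b, c) \<Rightarrow>
     (cmod a powr (4/3) + cmod b powr (4/3) + cmod c powr (4/3)) powr (3/4))"

text \<open>The constant is meant for subsets of \<^const>\<open>hpolys\<close>. The infimum is over reals, so its
  value is meaningful only if some admissible constant exists.\<close>

definition bh_const :: "(complex \<Rightarrow> complex \<Rightarrow> complex) set \<Rightarrow> real" where
  "bh_const E = Inf {D. D > 0 \<and> (\<forall>P\<in>E. coeff_norm P \<le> D * sup_norm P)}"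

end

theory Submission
  imports Defs
begin

text \<open>On the torus, \<open>\<bar>a z\<^sup>2 + b z w + c w\<^sup>2\<bar>\<close> is the distance from a point at distance \<open>\<bar>b\<bar>\<close> from the
  origin to a point of the ellipse with semi-axes \<open>\<bar>a\<bar> + \<bar>c\<bar>\<close> and \<open>\<bar>\<bar>a\<bar> - \<bar>c\<bar>\<bar>\<close>. Among
  all directions of \<open>b\<close>, the minor axis makes the largest such distance smallest; there its
  square is \<open>(\<bar>a\<bar> + \<bar>c\<bar>)\<^sup>2 (1 + \<bar>b\<bar>\<^sup>2 / (4 \<bar>a c\<bar>))\<close> if the maximizer is not the end point
  of the axis, and the other case reduces to this one by increasing the smaller of \<open>\<bar>a\<bar>\<close>,
  \<open>\<bar>c\<bar>\<close>. What remains is a real inequality, with equality at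
  \<open>z\<^sup>2 + 2 \<surd>2 z w - w\<^sup>2\<close>, which has real coefficients.\<close>

section \<open>Real inequalities for the moduli of the coefficients\<close>

text \<open>Hoelder's inequality with exponents 3 and 3/2 and weights \<open>sqrt 2\<close> and 1;
  the constant is 3/2 = 1/2 + 1, the sum of the inverse squares of the weights. Equality occurs at
  \<open>Y = sqrt 2 * X\<close>.\<close>

lemma cube_sum_squares_le:
  fixes X Y :: real
  assumes "X \<ge> 0" "Y \<ge> 0"
  shows "2 * (X\<^sup>2 + Y\<^sup>2) ^ 3 \<le> 3 * (sqrt 2 * X ^ 3 + Y ^ 3)\<^sup>2"
proof -
  \<comment> \<open>Rescaling clears \<open>sqrt 2\<close>; the equality case becomes the double
    root \<open>Y = 2 * U\<close>.\<close>
  define U where "U = X / sqrt 2"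
  have U: "U \<ge> 0" "X = sqrt 2 * U" using assms by (auto simp: U_def)
  have X2: "X\<^sup>2 = 2 * U\<^sup>2" by (simp add: U power_mult_distrib)
  have "sqrt 2 * X ^ 3 = (sqrt 2 ^ 2) ^ 2 * U ^ 3"
    unfolding U(2) by (simp only: power_mult_distrib power2_eq_square power3_eq_cube ac_simps)
  hence X3: "sqrt 2 * X ^ 3 = 4 * U ^ 3" by simp
  have "3 * (4 * U ^ 3 + Y ^ 3)\<^sup>2 - 2 * (2 * U\<^sup>2 + Y\<^sup>2) ^ 3
      = (Y - 2 * U)\<^sup>2 * (Y ^ 4 + 4 * Y ^ 3 * U + 8 * Y * U ^ 3 + 8 * U ^ 4)"
    by algebra
  moreover have "\<dots> \<ge> 0" using U assms by (intro mult_nonneg_nonneg add_nonneg_nonneg) auto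
  ultimately show ?thesis unfolding X2 X3 by linarith
qed

text \<open>Interpolation of the 4/3-norm of \<open>(x ^ 3, y ^ 3)\<close> between its 1-norm and
  its 2-norm.\<close>

lemma sum_fourth_powers_interpolation:
  fixes x y :: real
  assumes "x \<ge> 0" "y \<ge> 0"
  shows "(x ^ 4 + y ^ 4) ^ 3 \<le> (x ^ 3 + y ^ 3)\<^sup>2 * ((x ^ 3)\<^sup>2 + (y ^ 3)\<^sup>2)"
proof -
  have "(x ^ 3 + y ^ 3)\<^sup>2 * ((x ^ 3)\<^sup>2 + (y ^ 3)\<^sup>2) - (x ^ 4 + y ^ 4) ^ 3
      = x ^ 3 * y ^ 3 * ((x - y)\<^sup>2 * (2 * x ^ 4 + x ^ 3 * y + x * y ^ 3 + 2 * y ^ 4))"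
    by algebra
  moreover have "\<dots> \<ge> 0" using assms by (intro mult_nonneg_nonneg add_nonneg_nonneg) auto
  ultimately show ?thesis by linarith
qed

text \<open>Here \<open>x\<close>, \<open>y\<close>, \<open>z\<close> are the cube roots of \<open>\<bar>a\<bar>\<close>, \<open>\<bar>c\<bar>\<close>, \<open>\<bar>b\<bar>\<close>, which makes
  the powers \<open>4/3\<close> polynomial.\<close>

lemma coeff_bound_interior:
  fixes x y z :: real
  assumes "x > 0" "y > 0" "z \<ge> 0"
  shows "2 * (x ^ 4 + y ^ 4 + z ^ 4) ^ 3
    \<le> 3 * ((x ^ 3 + y ^ 3)\<^sup>2 * (1 + (z ^ 3)\<^sup>2 / (4 * x ^ 3 * y ^ 3)))\<^sup>2"
proof -
  define p q b where "p = x ^ 3" and "q = y ^ 3" and "b = z ^ 3"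
  \<comment> \<open>With \<open>X ^ 3 = K\<close> and \<open>Y ^ 3 = b^2\<close>,
    \<open>cube_sum_squares_le\<close> applied in either order reduces the claim to one of
    \<open>sqrt 2 * K + b^2 \<le> M\<close> and \<open>K + sqrt 2 * b^2 \<le> M\<close>.\<close>
  define X where "X = sqrt (x ^ 4 + y ^ 4)"
  define K where "K = X ^ 3"
  define Y where "Y = z\<^sup>2"
  define M where "M = (p + q)\<^sup>2 * (1 + b\<^sup>2 / (4 * p * q))"
  have pos: "p > 0" "q > 0" "b \<ge> 0" "X \<ge> 0" "Y \<ge> 0" "K \<ge> 0"
    using assms by (auto simp: p_def q_def b_def X_def Y_def K_def)
  have X2: "X\<^sup>2 = x ^ 4 + y ^ 4" using assms by (simp add: X_def)
  have Y2: "Y\<^sup>2 = z ^ 4" by (simp add: Y_def)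
  have Y3: "Y ^ 3 = b\<^sup>2" by (simp add: Y_def b_def flip: power_mult)
  have "K\<^sup>2 = (X\<^sup>2) ^ 3" by (simp add: K_def flip: power_mult)
  hence K2: "K\<^sup>2 \<le> (p + q)\<^sup>2 * (p\<^sup>2 + q\<^sup>2)"
    using sum_fourth_powers_interpolation[of x y] assms by (simp add: X2 p_def q_def)
  have Kle: "K \<le> (p + q)\<^sup>2"
  proof (rule power2_le_imp_le)
    have "(p + q)\<^sup>2 * (p\<^sup>2 + q\<^sup>2) \<le> (p + q)\<^sup>2 * (p + q)\<^sup>2"
      using pos by (intro mult_left_mono) (auto simp: power2_sum)
    thus "K\<^sup>2 \<le> ((p + q)\<^sup>2)\<^sup>2" using K2 by (simp add: power2_eq_square)
  qed simp
  \<comment> \<open>The right-hand side is the value of \<open>M - b^2\<close> at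
    \<open>b^2 = 2 * p * q\<close>, where the two cases below meet.\<close>
  have K2le: "sqrt 2 * K \<le> (p + q)\<^sup>2 + (p - q)\<^sup>2 / 2"
  proof (rule power2_le_imp_le)
    have "((p + q)\<^sup>2 + (p - q)\<^sup>2 / 2)\<^sup>2 - 2 * ((p + q)\<^sup>2 * (p\<^sup>2 + q\<^sup>2)) = ((p - q)\<^sup>2 / 2)\<^sup>2"
      by (simp add: power2_eq_square field_simps)
    hence "2 * ((p + q)\<^sup>2 * (p\<^sup>2 + q\<^sup>2)) \<le> ((p + q)\<^sup>2 + (p - q)\<^sup>2 / 2)\<^sup>2"
      using zero_le_power2[of "(p - q)\<^sup>2 / 2"] by linarith
    thus "(sqrt 2 * K)\<^sup>2 \<le> ((p + q)\<^sup>2 + (p - q)\<^sup>2 / 2)\<^sup>2"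
      using K2 by (simp add: power_mult_distrib)
  qed simp
  have M_eq: "M = (p + q)\<^sup>2 + b\<^sup>2 + b\<^sup>2 / (4 * p * q) * (p - q)\<^sup>2"
    using pos by (simp add: M_def field_simps power2_eq_square)
  \<comment> \<open>Above the threshold \<open>M - b^2\<close> is at least its value there, so
    \<open>K2le\<close> suffices. Below it the weights 1 and \<open>sqrt 2\<close> are
    exchanged.\<close>
  have "2 * (X\<^sup>2 + Y\<^sup>2) ^ 3 \<le> 3 * M\<^sup>2"
  proof (cases "b\<^sup>2 \<ge> 2 * p * q")
    case True
    have "1 / 2 \<le> b\<^sup>2 / (4 * p * q)"
      using True pos by (simp add: field_simps)
    hence "1 / 2 * (p - q)\<^sup>2 \<le> b\<^sup>2 / (4 * p * q) * (p - q)\<^sup>2"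
      by (rule mult_right_mono) simp
    hence "sqrt 2 * X ^ 3 + Y ^ 3 \<le> M" using K2le unfolding M_eq Y3 K_def by linarith
    hence "(sqrt 2 * X ^ 3 + Y ^ 3)\<^sup>2 \<le> M\<^sup>2" using pos by (intro power_mono) auto
    thus ?thesis using cube_sum_squares_le[of X Y] pos by linarith
  next
    case False
    define \<tau> where "\<tau> = b\<^sup>2 / (2 * p * q)"
    have \<tau>: "0 \<le> \<tau>" "\<tau> \<le> 1" using False pos by (auto simp: \<tau>_def field_simps)
    have b2: "b\<^sup>2 = 2 * p * q * \<tau>" using pos by (simp add: \<tau>_def)
    have M': "M = (p + q)\<^sup>2 + \<tau> * ((p + q)\<^sup>2 / 2)"
      using pos by (simp add: M_def \<tau>_def field_simps)
    have s2: "sqrt 2 \<le> 3 / 2" by (rule real_le_lsqrt) (auto simp: power2_eq_square)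
    \<comment> \<open>\<open>M - sqrt 2 * b^2 = (p + q)^2 + \<tau> * G\<close> is affine in
      \<open>\<tau>\<close>, so it is enough to compare it with \<open>K\<close> at
      \<open>\<tau> = 0\<close> (\<open>Kle\<close>) and \<open>\<tau> = 1\<close>
      (\<open>bd\<close>).\<close>
    define G where "G = (p + q)\<^sup>2 / 2 - 2 * sqrt 2 * (p * q)"
    have bd: "K \<le> (p + q)\<^sup>2 + G"
    proof -
      have "sqrt 2 * (sqrt 2 * K) \<le> sqrt 2 * ((p + q)\<^sup>2 + (p - q)\<^sup>2 / 2)"
        using K2le by (intro mult_left_mono) auto
      hence "2 * K \<le> sqrt 2 * ((p + q)\<^sup>2 + (p - q)\<^sup>2 / 2)" by (simp flip: mult.assoc)
      hence "2 * K + 4 * sqrt 2 * (p * q) \<le> sqrt 2 * ((p + q)\<^sup>2 + (p - q)\<^sup>2 / 2 + 4 * (p * q))"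
        by (simp add: algebra_simps)
      also have "\<dots> \<le> sqrt 2 * (2 * (p + q)\<^sup>2)"
        using zero_le_power2[of "p - q"]
        by (intro mult_left_mono) (simp_all add: power2_sum power2_diff field_simps)
      also have "\<dots> \<le> 3 / 2 * (2 * (p + q)\<^sup>2)" by (intro mult_right_mono s2) auto
      finally show ?thesis by (simp add: G_def)
    qed
    have "K + sqrt 2 * b\<^sup>2 \<le> M"
    proof -
      have "K \<le> (p + q)\<^sup>2 + \<tau> * G"
      proof (cases "G \<ge> 0")
        case True
        hence "0 \<le> \<tau> * G" using \<tau> by simp
        thus ?thesis using Kle by linarith
      next
        case False
        hence "\<tau> * G \<ge> 1 * G"
          using \<tau> by (intro mult_right_mono_neg) auto
        thus ?thesis using bd by linarith
      qed
      thus ?thesis unfolding M' b2 G_def by (simp add: algebra_simps)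
    qed
    hence "sqrt 2 * Y ^ 3 + X ^ 3 \<le> M" by (simp add: Y3 K_def)
    hence "(sqrt 2 * Y ^ 3 + X ^ 3)\<^sup>2 \<le> M\<^sup>2" using pos by (intro power_mono) auto
    thus ?thesis using cube_sum_squares_le[of Y X] pos by (simp add: add.commute)
  qed
  thus ?thesis unfolding X2 Y2 M_def p_def q_def b_def by (simp add: mult.assoc)
qed

text \<open>The expression bounded by \<open>M\<close> is concave in \<open>s\<close>. If its vertex
  is at most 1, inserting it gives the bound of \<open>coeff_bound_interior\<close>; otherwise
  \<open>s = 1\<close> is the best choice and gives a perfect square.\<close>

lemma coeff_bound_ordered:
  fixes x y z M :: real
  assumes "0 \<le> y" "y \<le> x" "0 \<le> z"
    and M: "\<And>s. 0 \<le> s \<Longrightarrow> s \<le> 1 \<Longrightarrow>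
      (x ^ 3 + y ^ 3)\<^sup>2 - 4 * x ^ 3 * y ^ 3 * s\<^sup>2 + 2 * (x ^ 3 - y ^ 3) * z ^ 3 * s + (z ^ 3)\<^sup>2 \<le> M"
  shows "2 * (x ^ 4 + y ^ 4 + z ^ 4) ^ 3 \<le> 3 * M\<^sup>2"
proof -
  define p q b where pqb: "p = x ^ 3" "q = y ^ 3" "b = z ^ 3"
  have ord: "0 \<le> q" "q \<le> p" "0 \<le> b" using assms by (auto simp: pqb power_mono)
  consider (interior) "x > 0" "y > 0" "(p - q) * b \<le> 4 * p * q"
    | (endpoint) "x > 0" "z > 0" "(p - q) * b \<ge> 4 * p * q"
    | (x) "z = 0" "y = 0" | (z) "x = 0" "y = 0"
  proof -
    have "(p - q) * b \<le> 4 * p * q" if "z = 0"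
      using that mult_nonneg_nonneg[OF order_trans[OF ord(1,2)] ord(1)] by (simp add: pqb(3))
    moreover have "(p - q) * b \<ge> 4 * p * q" if "y = 0"
      using that mult_nonneg_nonneg[OF order_trans[OF ord(1,2)] ord(3)] by (simp add: pqb(2))
    moreover have "x = 0 \<or> x > 0" "y = 0 \<or> y > 0" "z = 0 \<or> z > 0" "x = 0 \<Longrightarrow> y = 0"
      using assms by auto
    ultimately show ?thesis using that linear[of "(p - q) * b" "4 * p * q"] by blast
  qed
  thus ?thesis
  proof cases
    case interior
    have pq: "p > 0" "q > 0" using interior by (auto simp: pqb)
    define s where "s = (p - q) * b / (4 * p * q)"
    have "0 \<le> s" unfolding s_def using ord pq by (intro divide_nonneg_pos mult_nonneg_nonneg) auto
    moreover have "s \<le> 1" unfolding s_def using pq interior by (subst divide_le_eq_1_pos) auto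
    ultimately have s: "0 \<le> s" "s \<le> 1" .
    from M[OF s, folded pqb]
    have le: "(p + q)\<^sup>2 * (1 + b\<^sup>2 / (4 * p * q)) \<le> M"
    proof (rule order_trans[rotated])
      have "(p - q) * b = 4 * p * q * s" using pq by (simp add: s_def)
      hence "(p + q)\<^sup>2 - 4 * p * q * s\<^sup>2 + 2 * (p - q) * b * s + b\<^sup>2 = (p + q)\<^sup>2 + (p - q) * b * s + b\<^sup>2"
        by algebra
      also have "\<dots> = (p + q)\<^sup>2 * (1 + b\<^sup>2 / (4 * p * q))"
        using pq by (simp add: s_def field_simps power2_eq_square)
      finally show "(p + q)\<^sup>2 * (1 + b\<^sup>2 / (4 * p * q))
        \<le> (p + q)\<^sup>2 - 4 * p * q * s\<^sup>2 + 2 * (p - q) * b * s + b\<^sup>2" by simp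
    qed
    have "((p + q)\<^sup>2 * (1 + b\<^sup>2 / (4 * p * q)))\<^sup>2 \<le> M\<^sup>2"
      using pq by (intro power_mono le) auto
    thus ?thesis using coeff_bound_interior[of x y z] interior assms unfolding pqb by linarith
  next
    case endpoint
    have pb: "p > 0" "b > 0" using endpoint by (auto simp: pqb)
    \<comment> \<open>\<open>q'\<close> solves \<open>(p - q') b = 4 p q'\<close>, the border with the interior case\<close>
    define q' where "q' = p * b / (4 * p + b)"
    define y' where "y' = root 3 q'"
    have q': "q' > 0" "q' < p" using pb by (auto simp: q'_def field_simps)
    have eq: "(p - q') * b = 4 * p * q'" using pb by (simp add: q'_def field_simps)
    have y': "y' > 0" "y' ^ 3 = q'" using q' by (auto simp: y'_def)
    have qq': "q \<le> q'" using endpoint pb by (simp add: q'_def field_simps)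
    \<comment> \<open>The rule concerns the exponent \<open>Suc n\<close>, so 2 stands for the
      cube.\<close>
    hence "y \<le> y'" using y' assms by (intro power_le_imp_le_base[of y 2 y']) (auto simp: pqb numeral_3_eq_3)
    hence "y ^ 4 \<le> y' ^ 4" using assms by (intro power_mono) auto
    hence "2 * (x ^ 4 + y ^ 4 + z ^ 4) ^ 3 \<le> 2 * (x ^ 4 + y' ^ 4 + z ^ 4) ^ 3"
      using assms by (intro mult_left_mono power_mono) auto
    also have "\<dots> \<le> 3 * ((p + q')\<^sup>2 * (1 + b\<^sup>2 / (4 * p * q')))\<^sup>2"
      using coeff_bound_interior[of x y' z] endpoint y' by (simp add: pqb)
    \<comment> \<open>At the border the vertex is \<open>s = 1\<close>, so the interior maximum
      equals the endpoint value.\<close>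
    also have "(p + q')\<^sup>2 * (1 + b\<^sup>2 / (4 * p * q')) = (p - q' + b)\<^sup>2"
    proof -
      have "(p + q')\<^sup>2 = (p - q')\<^sup>2 + (p - q') * b" unfolding eq by (simp add: power2_eq_square algebra_simps)
      hence "(p + q')\<^sup>2 = (p - q') * (p - q' + b)" by (simp add: power2_eq_square algebra_simps)
      moreover have "1 + b\<^sup>2 / (4 * p * q') = (p - q' + b) / (p - q')"
        unfolding eq[symmetric] using q' pb by (simp add: field_simps power2_eq_square)
      ultimately show ?thesis using q' by (simp add: power2_eq_square)
    qed
    \<comment> \<open>Raising \<open>q\<close> to \<open>q'\<close> lowers the endpoint value, so
      \<open>M\<close> still dominates it.\<close>
    also have "3 * ((p - q' + b)\<^sup>2)\<^sup>2 \<le> 3 * M\<^sup>2"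
    proof -
      have "(p - q' + b)\<^sup>2 \<le> (p - q + b)\<^sup>2" using qq' q' pb by (intro power_mono) auto
      also have "\<dots> \<le> M" using M[of 1, folded pqb] by (simp add: power2_eq_square algebra_simps)
      finally show ?thesis by (intro mult_left_mono power_mono) auto
    qed
    finally show ?thesis .
  next
    case x
    have "x ^ 6 \<le> M" using M[of 0] x by (simp flip: power_mult)
    hence "(x ^ 6)\<^sup>2 \<le> M\<^sup>2" by (intro power_mono) auto
    hence "x ^ 12 \<le> M\<^sup>2" by (simp flip: power_mult)
    hence "2 * x ^ 12 \<le> 3 * M\<^sup>2" using zero_le_power2[of M] by linarith
    thus ?thesis using x by (simp flip: power_mult)
  next
    case z
    have "z ^ 6 \<le> M" using M[of 0] z by (simp flip: power_mult)
    hence "(z ^ 6)\<^sup>2 \<le> M\<^sup>2" by (intro power_mono) auto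
    hence "z ^ 12 \<le> M\<^sup>2" by (simp flip: power_mult)
    hence "2 * z ^ 12 \<le> 3 * M\<^sup>2" using zero_le_power2[of M] by linarith
    thus ?thesis using z by (simp flip: power_mult)
  qed
qed

lemma coeff_bound:
  fixes x y z M :: real
  assumes "0 \<le> x" "0 \<le> y" "0 \<le> z"
    and M: "\<And>s. 0 \<le> s \<Longrightarrow> s \<le> 1 \<Longrightarrow>
      (x ^ 3 + y ^ 3)\<^sup>2 - 4 * x ^ 3 * y ^ 3 * s\<^sup>2 + 2 * \<bar>x ^ 3 - y ^ 3\<bar> * z ^ 3 * s + (z ^ 3)\<^sup>2 \<le> M"
  shows "2 * (x ^ 4 + y ^ 4 + z ^ 4) ^ 3 \<le> 3 * M\<^sup>2"
proof (cases "y \<le> x")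
  case True
  hence "y ^ 3 \<le> x ^ 3" using assms by (intro power_mono)
  thus ?thesis using M assms True by (intro coeff_bound_ordered) auto
next
  case False
  hence "x ^ 3 \<le> y ^ 3" using assms by (intro power_mono) auto
  hence "2 * (y ^ 4 + x ^ 4 + z ^ 4) ^ 3 \<le> 3 * M\<^sup>2"
    using M assms False by (intro coeff_bound_ordered) (auto simp: ac_simps)
  thus ?thesis by (simp add: ac_simps)
qed

section \<open>Distances to an ellipse and values on the torus\<close>

text \<open>The left-hand side is the squared length for \<open>k = 0\<close> at the ellipse point
  with \<open>d = s\<close> or \<open>d = -s\<close>, the sign making \<open>B * d * l\<close>
  nonnegative. So no direction does worse than the minor axis.\<close>

lemma far_point_on_ellipse:
  fixes A B \<beta> k l s :: real
  assumes AB: "\<bar>B\<bar> \<le> A" and \<beta>: "\<beta> \<ge> 0" and kl: "k\<^sup>2 + l\<^sup>2 = 1" and s: "0 \<le> s" "s \<le> 1"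
  obtains c d where "c\<^sup>2 + d\<^sup>2 = 1"
    "A\<^sup>2 - (A\<^sup>2 - B\<^sup>2) * s\<^sup>2 + 2 * \<bar>B\<bar> * \<beta> * s + \<beta>\<^sup>2 \<le> (A * c + \<beta> * k)\<^sup>2 + (B * d + \<beta> * l)\<^sup>2"
proof -
  have B2: "B\<^sup>2 \<le> A\<^sup>2" using AB by (simp add: abs_le_square_iff[symmetric])
  have expand: "(A * c + \<beta> * k)\<^sup>2 + (B * d + \<beta> * l)\<^sup>2
      = A\<^sup>2 - (A\<^sup>2 - B\<^sup>2) * d\<^sup>2 + 2 * \<beta> * (A * (c * k) + B * d * l) + \<beta>\<^sup>2" if "c\<^sup>2 + d\<^sup>2 = 1" for c d
  proof -
    have "(A * c + \<beta> * k)\<^sup>2 + (B * d + \<beta> * l)\<^sup>2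
        = A\<^sup>2 * (c\<^sup>2 + d\<^sup>2) - (A\<^sup>2 - B\<^sup>2) * d\<^sup>2 + 2 * \<beta> * (A * (c * k) + B * d * l) + \<beta>\<^sup>2 * (k\<^sup>2 + l\<^sup>2)"
      by algebra
    thus ?thesis by (simp add: kl that)
  qed
  \<comment> \<open>By \<open>expand\<close> it suffices to bound \<open>d^2\<close> from above and
    the cross term from below by their minor-axis values. If \<open>|l| < s\<close>, the parameter
    \<open>(k, l)\<close> works up to the sign of \<open>l\<close>, because
    \<open>A \<ge> |B|\<close>; otherwise \<open>|d| = s\<close> with suitable signs works.\<close>
  have "\<exists>c d. c\<^sup>2 + d\<^sup>2 = 1 \<and> d\<^sup>2 \<le> s\<^sup>2 \<and> \<bar>B\<bar> * s \<le> A * (c * k) + B * d * l"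
  proof (cases "\<bar>l\<bar> < s")
    case True
    define d where "d = (if B \<ge> 0 then l else - l)"
    have d: "d\<^sup>2 = l\<^sup>2" "B * d * l = \<bar>B\<bar> * l\<^sup>2" by (auto simp: d_def power2_eq_square)
    have "\<bar>B\<bar> * s \<le> \<bar>B\<bar> * (k\<^sup>2 + l\<^sup>2)" unfolding kl using s by (intro mult_left_mono) auto
    also have "\<dots> \<le> A * k\<^sup>2 + B * d * l"
      using AB unfolding d distrib_left by (intro add_right_mono mult_right_mono) auto
    finally have "\<bar>B\<bar> * s \<le> A * (k * k) + B * d * l" by (simp add: power2_eq_square)
    moreover have "d\<^sup>2 \<le> s\<^sup>2" using True by (simp add: d abs_le_square_iff[symmetric])
    ultimately show ?thesis using kl d(1) by (intro exI[of _ k] exI[of _ d]) simp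
  next
    case False
    define c where "c = (if k \<ge> 0 then sqrt (1 - s\<^sup>2) else - sqrt (1 - s\<^sup>2))"
    define d where "d = (if B * l \<ge> 0 then s else - s)"
    have "s\<^sup>2 \<le> 1" using s by (simp add: power_le_one)
    hence c: "c\<^sup>2 = 1 - s\<^sup>2" "c * k = sqrt (1 - s\<^sup>2) * \<bar>k\<bar>" by (auto simp: c_def)
    have d: "d\<^sup>2 = s\<^sup>2" "B * d * l = \<bar>B\<bar> * (s * \<bar>l\<bar>)"
    proof -
      have "B * d * l = s * \<bar>B * l\<bar>" by (simp add: d_def)
      thus "B * d * l = \<bar>B\<bar> * (s * \<bar>l\<bar>)" by (simp add: abs_mult)
    qed (simp add: d_def)
    have "l\<^sup>2 \<le> 1" using kl zero_le_power2[of k] by linarith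
    hence l: "\<bar>l\<bar> \<le> 1" by (simp add: abs_square_le_1)
    \<comment> \<open>With \<open>s = sin u\<close> and \<open>|l| = sin v\<close>, where
      \<open>0 \<le> u \<le> v \<le> pi/2\<close>, this says \<open>cos (v - u) \<ge> sin u\<close>,
      which holds since \<open>v - u \<le> pi/2 - u\<close>.\<close>
    have "s * (1 - \<bar>l\<bar>) \<le> sqrt (1 - s\<^sup>2) * \<bar>k\<bar>"
    proof (rule power2_le_imp_le)
      have "(1 - \<bar>l\<bar>) * s\<^sup>2 \<le> (1 + \<bar>l\<bar>) * (1 - s\<^sup>2)"
      proof -
        have "s\<^sup>2 \<le> s * 1" unfolding power2_eq_square using s by (intro mult_left_mono) auto
        thus ?thesis using False s mult_left_mono[of "s\<^sup>2" s 2] by (simp add: algebra_simps)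
      qed
      hence "(1 - \<bar>l\<bar>) * ((1 - \<bar>l\<bar>) * s\<^sup>2) \<le> (1 - \<bar>l\<bar>) * ((1 + \<bar>l\<bar>) * (1 - s\<^sup>2))"
        using l by (intro mult_left_mono) auto
      also have "\<dots> = (1 - s\<^sup>2) * (1 - \<bar>l\<bar>\<^sup>2)" by (simp add: power2_eq_square algebra_simps)
      also have "\<dots> = (sqrt (1 - s\<^sup>2) * \<bar>k\<bar>)\<^sup>2"
        using kl \<open>s\<^sup>2 \<le> 1\<close> by (simp add: power_mult_distrib)
      finally show "(s * (1 - \<bar>l\<bar>))\<^sup>2 \<le> (sqrt (1 - s\<^sup>2) * \<bar>k\<bar>)\<^sup>2"
        by (simp add: power2_eq_square mult_ac)
    qed (use \<open>s\<^sup>2 \<le> 1\<close> in simp)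
    hence "s \<le> sqrt (1 - s\<^sup>2) * \<bar>k\<bar> + s * \<bar>l\<bar>" by (simp add: algebra_simps)
    hence "\<bar>B\<bar> * s \<le> \<bar>B\<bar> * (sqrt (1 - s\<^sup>2) * \<bar>k\<bar> + s * \<bar>l\<bar>)" by (intro mult_left_mono) auto
    also have "\<dots> \<le> A * (c * k) + B * d * l"
      unfolding c d distrib_left using AB \<open>s\<^sup>2 \<le> 1\<close> by (intro add_right_mono mult_right_mono) auto
    finally show ?thesis using c(1) d(1) by (intro exI[of _ c] exI[of _ d]) simp
  qed
  then obtain c d where cd: "c\<^sup>2 + d\<^sup>2 = 1" "d\<^sup>2 \<le> s\<^sup>2" "\<bar>B\<bar> * s \<le> A * (c * k) + B * d * l" by blast
  have "(A\<^sup>2 - B\<^sup>2) * d\<^sup>2 \<le> (A\<^sup>2 - B\<^sup>2) * s\<^sup>2" using B2 cd by (intro mult_left_mono) auto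
  moreover have "2 * \<beta> * (\<bar>B\<bar> * s) \<le> 2 * \<beta> * (A * (c * k) + B * d * l)"
    using \<beta> cd by (intro mult_left_mono) auto
  ultimately show thesis
    by (intro that[OF cd(1)]) (simp add: expand[OF cd(1)] mult_ac)
qed

text \<open>Rotating \<open>z\<close> and \<open>w\<close> gives \<open>a * z^2\<close> and
  \<open>c * w^2\<close> the opposite phases \<open>\<theta>\<close> and \<open>- \<theta>\<close>,
  so their sum runs over the ellipse, while \<open>\<theta>\<close> cancels in
  \<open>b * z * w\<close>, whose phase stays \<open>\<phi>\<close>.\<close>

lemma hpoly_torus:
  fixes a b c :: complex
  assumes "0 \<le> s" "s \<le> 1"
  obtains z w where "cmod z = 1" "cmod w = 1"
    "(cmod a + cmod c)\<^sup>2 - 4 * cmod a * cmod c * s\<^sup>2 + 2 * \<bar>cmod a - cmod c\<bar> * cmod b * s + (cmod b)\<^sup>2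
      \<le> (cmod (hpoly a b c z w))\<^sup>2"
proof -
  define \<phi> where "\<phi> = Arg b - Arg a / 2 - Arg c / 2"
  have "\<bar>cmod a - cmod c\<bar> \<le> cmod a + cmod c" by (simp add: abs_if)
  then obtain u v where uv: "u\<^sup>2 + v\<^sup>2 = 1"
    "(cmod a + cmod c)\<^sup>2 - ((cmod a + cmod c)\<^sup>2 - (cmod a - cmod c)\<^sup>2) * s\<^sup>2
        + 2 * \<bar>cmod a - cmod c\<bar> * cmod b * s + (cmod b)\<^sup>2
      \<le> ((cmod a + cmod c) * u + cmod b * cos \<phi>)\<^sup>2 + ((cmod a - cmod c) * v + cmod b * sin \<phi>)\<^sup>2"
    using far_point_on_ellipse[of "cmod a - cmod c" "cmod a + cmod c" "cmod b" "cos \<phi>" "sin \<phi>" s] assms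
    by auto
  then obtain \<theta> where \<theta>: "u = cos \<theta>" "v = sin \<theta>" using sincos_total_2pi[of u v] by metis
  define z w where "z = cis (\<theta> / 2 - Arg a / 2)" and "w = cis (- \<theta> / 2 - Arg c / 2)"
  have "a * z\<^sup>2 = rcis (cmod a) (Arg a) * z\<^sup>2" by (simp add: rcis_cmod_Arg)
  also have "\<dots> = rcis (cmod a) \<theta>" by (simp add: z_def rcis_def Complex.DeMoivre cis_mult)
  finally have az: "a * z\<^sup>2 = rcis (cmod a) \<theta>" .
  have "c * w\<^sup>2 = rcis (cmod c) (Arg c) * w\<^sup>2" by (simp add: rcis_cmod_Arg)
  also have "\<dots> = rcis (cmod c) (- \<theta>)" by (simp add: w_def rcis_def Complex.DeMoivre cis_mult)
  finally have cw: "c * w\<^sup>2 = rcis (cmod c) (- \<theta>)" .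
  have "b * z * w = rcis (cmod b) (Arg b) * z * w" by (simp add: rcis_cmod_Arg)
  also have "\<dots> = rcis (cmod b) (Arg b + (\<theta> / 2 - Arg a / 2) + (- \<theta> / 2 - Arg c / 2))"
    by (simp only: z_def w_def rcis_def cis_mult mult.assoc add.assoc)
  also have "Arg b + (\<theta> / 2 - Arg a / 2) + (- \<theta> / 2 - Arg c / 2) = \<phi>" by (simp add: \<phi>_def)
  finally have bzw: "b * z * w = rcis (cmod b) \<phi>" .
  have "hpoly a b c z w = rcis (cmod a) \<theta> + rcis (cmod b) \<phi> + rcis (cmod c) (- \<theta>)"
    by (simp only: hpoly_def az bzw cw)
  hence "(cmod (hpoly a b c z w))\<^sup>2
    = ((cmod a + cmod c) * u + cmod b * cos \<phi>)\<^sup>2 + ((cmod a - cmod c) * v + cmod b * sin \<phi>)\<^sup>2"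
    by (simp add: cmod_power2 \<theta> algebra_simps)
  moreover have "4 * cmod a * cmod c = (cmod a + cmod c)\<^sup>2 - (cmod a - cmod c)\<^sup>2"
    by (simp add: power2_eq_square algebra_simps)
  ultimately show thesis using uv by (intro that[of z w]) (simp_all add: z_def w_def)
qed

section \<open>The upper bound for the constant\<close>

text \<open>Ensures that the real \<open>Sup\<close> in \<open>sup_norm\<close> is a genuine least
  upper bound.\<close>

lemma bdd_above_hpoly: "bdd_above {cmod (hpoly a b c z w) | z w. cmod z \<le> 1 \<and> cmod w \<le> 1}"
proof (rule bdd_aboveI, clarify)
  fix z w :: complex assume zw: "cmod z \<le> 1" "cmod w \<le> 1"
  have "cmod (hpoly a b c z w) \<le> cmod (a * z\<^sup>2) + cmod (b * z * w) + cmod (c * w\<^sup>2)"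
    unfolding hpoly_def by (intro norm_triangle_mono order_refl)
  also have "\<dots> \<le> cmod a * 1 + cmod b * (1 * 1) + cmod c * 1"
    unfolding norm_mult norm_power mult.assoc using zw
    by (intro add_mono mult_mono mult_left_mono power_le_one) auto
  finally show "cmod (hpoly a b c z w) \<le> cmod a * 1 + cmod b * (1 * 1) + cmod c * 1" .
qed

lemma cmod_hpoly_le_sup_norm:
  assumes "cmod z \<le> 1" "cmod w \<le> 1"
  shows "cmod (hpoly a b c z w) \<le> sup_norm (hpoly a b c)"
  unfolding sup_norm_def using assms by (intro cSup_upper bdd_above_hpoly) auto

lemma coeff_norm_le_sup_norm: "coeff_norm (hpoly a b c) \<le> root 4 (3 / 2) * sup_norm (hpoly a b c)"
proof -
  define N where "N = sup_norm (hpoly a b c)"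
  have N0: "0 \<le> N" unfolding N_def
    using cmod_hpoly_le_sup_norm[of 0 0 a b c] by (simp add: hpoly_def)
  define x y z where "x = root 3 (cmod a)" and "y = root 3 (cmod c)" and "z = root 3 (cmod b)"
  have cube: "x ^ 3 = cmod a" "y ^ 3 = cmod c" "z ^ 3 = cmod b" and nn: "x \<ge> 0" "y \<ge> 0" "z \<ge> 0"
    by (simp_all add: x_def y_def z_def)
  have root_powr: "root 3 t ^ 4 = t powr (4 / 3)" if "t \<ge> 0" for t :: real
    using that by (cases "t = 0") (simp_all add: root_powr_inverse powr_powr flip: powr_realpow)
  define S where "S = x ^ 4 + y ^ 4 + z ^ 4"
  have coeff: "coeff_norm (hpoly a b c) = S powr (3 / 4)"
    by (simp add: coeff_norm_def S_def x_def y_def z_def root_powr add_ac)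
  \<comment> \<open>\<open>coeff_bound\<close> with \<open>M = N^2\<close>: for each
    \<open>s\<close> a torus point attains at least the required value.\<close>
  have "2 * S ^ 3 \<le> 3 * (N\<^sup>2)\<^sup>2" unfolding S_def
  proof (rule coeff_bound[OF nn(1,2,3)])
    fix s :: real assume "0 \<le> s" "s \<le> 1"
    then obtain z' w where zw: "cmod z' = 1" "cmod w = 1"
      "(cmod a + cmod c)\<^sup>2 - 4 * cmod a * cmod c * s\<^sup>2 + 2 * \<bar>cmod a - cmod c\<bar> * cmod b * s + (cmod b)\<^sup>2
        \<le> (cmod (hpoly a b c z' w))\<^sup>2" by (rule hpoly_torus)
    have "(cmod (hpoly a b c z' w))\<^sup>2 \<le> N\<^sup>2"
      unfolding N_def using zw by (intro power_mono cmod_hpoly_le_sup_norm) auto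
    with zw(3) show "(x ^ 3 + y ^ 3)\<^sup>2 - 4 * x ^ 3 * y ^ 3 * s\<^sup>2 + 2 * \<bar>x ^ 3 - y ^ 3\<bar> * z ^ 3 * s + (z ^ 3)\<^sup>2 \<le> N\<^sup>2"
      unfolding cube by linarith
  qed
  hence le: "S ^ 3 \<le> 3 / 2 * N ^ 4" by (simp flip: power_mult)
  have "S \<ge> 0" using nn by (simp add: S_def)
  hence "S powr (3 / 4) = root 4 (S ^ 3)"
    by (cases "S = 0") (simp_all add: root_powr_inverse powr_powr flip: powr_numeral)
  also have "\<dots> \<le> root 4 (3 / 2 * N ^ 4)" using le by simp
  also have "\<dots> = root 4 (3 / 2) * N" by (subst real_root_mult) (simp add: real_root_power_cancel N0)
  finally show ?thesis unfolding coeff N_def .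
qed

section \<open>Sharpness and the two constants\<close>

text \<open>The equality case \<open>x = y = 1\<close>, \<open>z = sqrt 2\<close> of
  \<open>coeff_bound_interior\<close>. The ellipse is flattened to a segment of half-length 2, and
  the middle term, of length \<open>2 * sqrt 2\<close>, is perpendicular to it; hence the maximum
  \<open>sqrt (4 + 8)\<close>.\<close>

definition extremal_hpoly :: "complex \<Rightarrow> complex \<Rightarrow> complex" where
  "extremal_hpoly = hpoly 1 (of_real (2 * sqrt 2)) (- 1)"

lemma sup_norm_extremal_le: "sup_norm extremal_hpoly \<le> sqrt 12"
  unfolding sup_norm_def
proof (rule cSup_least)
  let ?S = "{cmod (extremal_hpoly z w) | z w. cmod z \<le> 1 \<and> cmod w \<le> 1}"
  have "cmod (extremal_hpoly 0 0) \<in> ?S"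
    by (intro CollectI exI[of _ 0]) simp
  thus "?S \<noteq> {}" by (metis empty_iff)
next
  fix r assume "r \<in> {cmod (extremal_hpoly z w) | z w. cmod z \<le> 1 \<and> cmod w \<le> 1}"
  then obtain z w where r: "r = cmod (extremal_hpoly z w)" and zw: "cmod z \<le> 1" "cmod w \<le> 1"
    by blast
  define A B x where "A = (cmod z)\<^sup>2" and "B = (cmod w)\<^sup>2" and "x = Re (z * cnj w)"
  have AB: "0 \<le> A" "A \<le> 1" "0 \<le> B" "B \<le> 1" using zw by (auto simp: A_def B_def power_le_one)
  have "(cmod (extremal_hpoly z w))\<^sup>2
      = A\<^sup>2 + B\<^sup>2 + 2 * (A * B) + (sqrt 2)\<^sup>2 * 4 * (A * B) - 4 * x\<^sup>2 + 4 * sqrt 2 * (A - B) * x"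
    unfolding extremal_hpoly_def hpoly_def A_def B_def x_def cmod_power2
    by (simp add: power2_eq_square algebra_simps)
  \<comment> \<open>Completing the square in \<open>x\<close>.\<close>
  also have "\<dots> = 3 * (A + B)\<^sup>2 - (2 * x - sqrt 2 * (A - B))\<^sup>2"
    by (simp add: power2_diff power_mult_distrib) (simp add: power2_eq_square algebra_simps)
  also have "\<dots> \<le> 3 * 2\<^sup>2" using AB power_mono[of "A + B" 2 2] zero_le_power2[of "2 * x - sqrt 2 * (A - B)"] by linarith
  finally show "r \<le> sqrt 12" unfolding r by (intro real_le_rsqrt) simp
qed

text \<open>The ratio of the norms is at least \<open>6 powr (3/4) / sqrt 12\<close>, whose fourth
  power is 216/144 = 3/2.\<close>

lemma extremal_lower_bound:
  assumes "D > 0" "coeff_norm extremal_hpoly \<le> D * sup_norm extremal_hpoly"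
  shows "root 4 (3 / 2) \<le> D"
proof -
  have "(2 * sqrt 2 :: real) = 2 powr (3 / 2)"
    using powr_add[of "2::real" 1 "1/2"] by (simp add: powr_half_sqrt)
  hence "(2 * sqrt 2 :: real) powr (4 / 3) = 4"
    by (simp add: powr_powr)
  hence "coeff_norm extremal_hpoly = 6 powr (3 / 4)"
    by (simp add: coeff_norm_def extremal_hpoly_def norm_mult)
  hence "6 powr (3 / 4) \<le> D * sqrt 12"
    using assms mult_left_mono[OF sup_norm_extremal_le, of D] by linarith
  hence "(6 powr (3 / 4)) ^ 4 \<le> (D * sqrt 12) ^ 4" by (intro power_mono) auto
  moreover have "(6 powr (3 / 4) :: real) ^ 4 = 216" by (simp add: powr_powr flip: powr_realpow)
  moreover have "(D * sqrt 12) ^ 4 = D ^ 4 * ((sqrt 12)\<^sup>2)\<^sup>2" by (simp only: power_mult_distrib flip: power_mult) simp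
  ultimately have "3 / 2 \<le> D ^ 4" by simp
  hence "root 4 (3 / 2) \<le> root 4 (D ^ 4)" by simp
  thus ?thesis using assms by (simp add: real_root_power_cancel)
qed

text \<open>One extremal polynomial with real coefficients serves both families: the upper bound
  passes to every subset, and the infimum is attained.\<close>

lemma bh_const_eqI:
  assumes "E \<subseteq> hpolys" "extremal_hpoly \<in> E"
  shows "bh_const E = root 4 (3 / 2)"
  unfolding bh_const_def
proof (rule cInf_eq_minimum)
  show "root 4 (3 / 2) \<in> {D. D > 0 \<and> (\<forall>P\<in>E. coeff_norm P \<le> D * sup_norm P)}"
    using assms(1) coeff_norm_le_sup_norm by (force simp: hpolys_def)
qed (use assms(2) extremal_lower_bound in auto)

theorem theorem2p3:
  shows "bh_const real_hpolys = root 4 (3/2)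
    \<and> bh_const hpolys = root 4 (3/2)
    \<and> 1.1066 \<le> root 4 (3/2 :: real) \<and> root 4 (3/2 :: real) < 1.1067"
proof (intro conjI)
  have "extremal_hpoly \<in> real_hpolys"
    unfolding real_hpolys_def extremal_hpoly_def
    by (intro CollectI exI[of _ 1] exI[of _ "2 * sqrt 2"] exI[of _ "- 1"]) simp
  moreover have "real_hpolys \<subseteq> hpolys" by (auto simp: real_hpolys_def hpolys_def)
  ultimately show "bh_const real_hpolys = root 4 (3/2)" "bh_const hpolys = root 4 (3/2)"
    by (auto intro!: bh_const_eqI)
  \<comment> \<open>Fourth powers turn both decimal bounds into rational arithmetic.\<close>
  have "root 4 (1.1066 ^ 4) \<le> root 4 (3 / 2 :: real)" by (simp add: power_divide)
  thus "1.1066 \<le> root 4 (3/2 :: real)" by (simp add: real_root_power_cancel)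
  have "root 4 (3 / 2 :: real) < root 4 (1.1067 ^ 4)" by (simp add: power_divide)
  thus "root 4 (3/2 :: real) < 1.1067" by (simp add: real_root_power_cancel)
qed

end
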